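(* Assume that $G$ is a finitely generated group with exponential growth and $H$ is a finitely generated group with polynomial growth of degree $d$. Then $G\times H$ (with respect to any finite symmetric generating set) does not have the $\{f(n)\}$-retainment property for any function $f$ satisfying $f(n)=o(n^{d-1})$.
   Context: For a finitely generated group $G$ with finite symmetric generating set $S$, consider its Cayley graph, with vertex set $G$ and edges $x\sim xs$, $s\in S$. Let $B_n$ be the ball of radius $n$ around the identity for the graph distance and $v_G(n)=|B_n|$. For functions write $a\preceq b$ if there is a constant $C>0$ with $a(n)\le C\,b(Cn)+C$ for all $n$, and $a\simeq b$ (equivalent) if $a\preceq b$ and $b\preceq a$. $G$ has exponential growth if $v_G(n)\simeq\gamma^n$ for some $\gamma>1$; it has polynomial growth of degree (order) $d$ if $v_G(n)/n^d$ is bounded above and below by positive constants for $n\geq 1$. Fire process on a Cayley graph $\Gamma$: let $f$ be a sequence of non-negative integers $f(n)$, $n\ge 1$. A fire breaks out at time $0$ on a finite set $F_0$ of vertices. At each time $n\ge 1$ a set $W_n$ of at most $f(n)$ vertices not on fire ($W_n\cap F_{n-1}=\emptyset$) is declared protected forever, and then $F_n=F_{n-1}\cup\{x : x\sim y \text{ for some } y\in F_{n-1},\ x\notin W_1\cup\dots\cup W_n\}$. Such a sequence $\{W_n\}$ is an $\{f(n)\}$-allowed strategy. Let $U=\Gamma\setminus\bigcup_n F_n$ be the set of vertices never on fire. $\Gamma$ has the $\{f(n)\}$-retainment property if for every finite $F_0$ there is an $\{f(n)\}$-allowed strategy such that $n\mapsto|U\cap B_n|$ is equivalent to $v_\Ga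mma$.
   Formalization: The formal statement assumes d ≥ 1 (H infinite); for d = 0 the claim fails, e.g. G free of rank 2, H trivial, f = (1,0,0,…): protecting one vertex just outside the fire saves a whole branch of the tree. *)

theory Defs
  imports Complex_Main "HOL-Algebra.Algebra" "HOL-Library.Landau_Symbols"
begin

definition symmetric_generating_set :: "('a, 'b) monoid_scheme \<Rightarrow> 'a set \<Rightarrow> bool" where
  "symmetric_generating_set G S \<longleftrightarrow>
     finite S \<and> S \<subseteq> carrier G \<and> (\<forall>s\<in>S. inv\<^bsub>G\<^esub> s \<in> S) \<and> generate G S = carrier G"

text \<open>The (right) Cayley graph, as its adjacency relation on \<open>carrier G\<close>; it is a symmetric
  relation when \<open>S\<close> is closed under inverses.\<close>

definition cayley_adj :: "('a, 'b) monoid_scheme \<Rightarrow> 'a set \<Rightarrow> 'a rel" where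
  "cayley_adj G S = {(x, x \<otimes>\<^bsub>G\<^esub> s) | x s. x \<in> carrier G \<and> s \<in> S}"

text \<open>Graph distance at most \<open>n\<close> from the identity: joined to it by a path of at most \<open>n\<close> edges.\<close>

definition cayley_ball :: "('a, 'b) monoid_scheme \<Rightarrow> 'a set \<Rightarrow> nat \<Rightarrow> 'a set" where
  "cayley_ball G S n = {x. \<exists>k\<le>n. (\<one>\<^bsub>G\<^esub>, x) \<in> cayley_adj G S ^^ k}"

definition growth :: "('a, 'b) monoid_scheme \<Rightarrow> 'a set \<Rightarrow> nat \<Rightarrow> real" where
  "growth G S n = real (card (cayley_ball G S n))"

text \<open>The constant is an integer so that \<open>C * n\<close> is again an argument of \<open>b\<close>. For the nonnegative
  nondecreasing functions compared below, a real constant can always be rounded up.\<close>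

definition growth_le :: "(nat \<Rightarrow> real) \<Rightarrow> (nat \<Rightarrow> real) \<Rightarrow> bool" where
  "growth_le a b \<longleftrightarrow> (\<exists>C::nat. C > 0 \<and> (\<forall>n. a n \<le> real C * b (C * n) + real C))"

definition growth_equiv :: "(nat \<Rightarrow> real) \<Rightarrow> (nat \<Rightarrow> real) \<Rightarrow> bool" where
  "growth_equiv a b \<longleftrightarrow> growth_le a b \<and> growth_le b a"

definition exponential_growth :: "('a, 'b) monoid_scheme \<Rightarrow> 'a set \<Rightarrow> bool" where
  "exponential_growth G S \<longleftrightarrow> (\<exists>\<gamma>::real. \<gamma> > 1 \<and> growth_equiv (growth G S) (\<lambda>n. \<gamma> ^ n))"

definition polynomial_growth :: "('a, 'b) monoid_scheme \<Rightarrow> 'a set \<Rightarrow> nat \<Rightarrow> bool" where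
  "polynomial_growth G S d \<longleftrightarrow>
     (\<exists>c1 c2::real. c1 > 0 \<and> c2 > 0 \<and>
        (\<forall>n\<ge>1. c1 \<le> growth G S n / real n ^ d \<and> growth G S n / real n ^ d \<le> c2))"

text \<open>\<open>fire E F0 W n\<close> is the set on fire at time \<open>n\<close> in the graph with adjacency relation \<open>E\<close>, where
  \<open>W i\<close> is the set newly protected at time \<open>i \<ge> 1\<close>; the value \<open>W 0\<close> is never used.\<close>

primrec fire :: "'a rel \<Rightarrow> 'a set \<Rightarrow> (nat \<Rightarrow> 'a set) \<Rightarrow> nat \<Rightarrow> 'a set" where
  "fire E F0 W 0 = F0"
| "fire E F0 W (Suc n) = fire E F0 W n \<union> (E `` fire E F0 W n - (\<Union>i\<in>{1..Suc n}. W i))"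

definition allowed_strategy ::
  "'a set \<Rightarrow> 'a rel \<Rightarrow> (nat \<Rightarrow> nat) \<Rightarrow> 'a set \<Rightarrow> (nat \<Rightarrow> 'a set) \<Rightarrow> bool" where
  "allowed_strategy V E f F0 W \<longleftrightarrow>
     (\<forall>n\<ge>1. W n \<subseteq> V \<and> finite (W n) \<and> card (W n) \<le> f n \<and> W n \<inter> fire E F0 W (n - 1) = {})"

definition never_on_fire :: "'a set \<Rightarrow> 'a rel \<Rightarrow> 'a set \<Rightarrow> (nat \<Rightarrow> 'a set) \<Rightarrow> 'a set" where
  "never_on_fire V E F0 W = V - (\<Union>n. fire E F0 W n)"

definition retainment_property ::
  "('a, 'b) monoid_scheme \<Rightarrow> 'a set \<Rightarrow> (nat \<Rightarrow> nat) \<Rightarrow> bool" where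
  "retainment_property G S f \<longleftrightarrow>
     (\<forall>F0. F0 \<subseteq> carrier G \<and> finite F0 \<longrightarrow>
       (\<exists>W. allowed_strategy (carrier G) (cayley_adj G S) f F0 W \<and>
         growth_equiv
           (\<lambda>n. real (card (never_on_fire (carrier G) (cayley_adj G S) F0 W \<inter> cayley_ball G S n)))
           (growth G S)))"

end

theory Submission imports Defs "HOL-Real_Asymp.Real_Asymp" begin

text \<open>
  Since \<open>f(n) = o(n\<^sup>d\<^sup>-\<^sup>1)\<close>, only \<open>o(n\<^sup>d)\<close> vertices have been protected by time \<open>K n\<close>, for every
  constant \<open>K\<close>. The set \<open>Q\<close> of vertices within a constant distance of these still has size
  \<open>o(n\<^sup>d)\<close>. Call a coset \<open>{g} \<times> H\<close> or \<open>G \<times> {h}\<close> clean if it does not meet \<open>Q\<close>. The fire runs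
  freely along a clean coset, at a speed that depends only on the generating sets, even though
  the given generators of the product may leave the coset: a detour of bounded length around
  each edge of the coset avoids all protected vertices.

  The point of the proof is that a vertex \<open>(g, h)\<close> of the ball of radius \<open>n\<close> can only survive if
  its coset \<open>{g} \<times> H\<close> is dirty. Indeed, suppose that at time \<open>n\<close> some vertex \<open>(a, b)\<close> with
  \<open>{a} \<times> H\<close> clean is burning. The ball of radius \<open>n\<close> in \<open>H\<close> has about \<open>n\<^sup>d\<close> elements, more than
  \<open>Q\<close>, so \<open>G \<times> {k}\<close> is clean for some \<open>k\<close> in it. If \<open>{g} \<times> H\<close> is clean too, the fire travels from
  \<open>(a, b)\<close> to \<open>(a, k)\<close>, \<open>(g, k)\<close> and \<open>(g, h)\<close>, all in linear time
  (\<open>unburnt_in_dirty_fibres\<close>). There are \<open>o(n\<^sup>d)\<close> dirty cosets \<open>{g} \<times> H\<close>, and each has at most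
  \<open>O(n\<^sup>d)\<close> vertices in the ball, so \<open>O(n\<^sup>2\<^sup>d)\<close> vertices of the ball survive, whereas the product has
  exponential growth.

  It remains to see that the fire reaches a clean coset \<open>{a} \<times> H\<close> by time \<open>n\<close>. Otherwise the
  burning set lies in \<open>O(n\<^sup>2\<^sup>d)\<close> vertices, so it suffices that it outgrows this bound. A set \<open>A\<close> in
  a group with \<open>|B\<^sub>r| \<ge> 2 |A|\<close> has at least \<open>|A| / (2 r)\<close> outer boundary vertices (\<open>isoperimetry\<close>),
  and here \<open>r\<close> may be taken far smaller than \<open>n\<close> as long as \<open>A\<close> is polynomial in \<open>n\<close>. A
  burning set of size about \<open>n\<^sup>p\<close> thus has a boundary that exceeds both the increment of \<open>n\<^sup>p\<close> and
  the number of protected vertices. Starting from a large enough set, the fire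
  therefore beats any prescribed power of \<open>n\<close> under every strategy (\<open>superpolynomial_fire\<close>).
\<close>

section \<open>Balls in Cayley graphs\<close>

locale cayley = group G for G (structure) +
  fixes S
  assumes generating: "symmetric_generating_set G S"
begin

abbreviation ball :: "nat \<Rightarrow> 'a set" where "ball \<equiv> cayley_ball G S"

abbreviation adj :: "'a rel" where "adj \<equiv> cayley_adj G S"

lemma finite_generators: "finite S"
  and generators_closed: "S \<subseteq> carrier G"
  and generators_inv: "s \<in> S \<Longrightarrow> inv s \<in> S"
  and generate_generators: "generate G S = carrier G"
  using generating unfolding symmetric_generating_set_def by auto

lemma adj_iff: "(x, y) \<in> adj \<longleftrightarrow> x \<in> carrier G \<and> (\<exists>s\<in>S. y = x \<otimes> s)"
  unfolding cayley_adj_def by auto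

lemma ball_0: "ball 0 = {\<one>}"
  unfolding cayley_ball_def by auto

lemma ball_mono: "m \<le> n \<Longrightarrow> ball m \<subseteq> ball n"
  unfolding cayley_ball_def using le_trans by blast

lemma ball_SucI:
  assumes "x \<in> ball n" "x \<in> carrier G" "s \<in> S"
  shows "x \<otimes> s \<in> ball (Suc n)"
proof -
  obtain k where k: "k \<le> n" "(\<one>, x) \<in> adj ^^ k"
    using assms(1) unfolding cayley_ball_def by auto
  have "(x, x \<otimes> s) \<in> adj"
    using assms adj_iff by blast
  then have "(\<one>, x \<otimes> s) \<in> adj ^^ Suc k"
    using k(2) by auto
  then show ?thesis
    unfolding cayley_ball_def using k(1) by (intro CollectI exI[of _ "Suc k"]) simp
qed

lemma ball_SucE:
  assumes "x \<in> ball (Suc n)"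
  obtains "x \<in> ball n" | y s where "y \<in> ball n" "y \<in> carrier G" "s \<in> S" "x = y \<otimes> s"
proof -
  obtain k where k: "k \<le> Suc n" "(\<one>, x) \<in> adj ^^ k"
    using assms unfolding cayley_ball_def by auto
  show ?thesis
  proof (cases "k \<le> n")
    case True
    then have "x \<in> ball n"
      using k unfolding cayley_ball_def by auto
    then show ?thesis
      using that by blast
  next
    case False
    then have "k = Suc n"
      using k by simp
    then obtain y where y: "(\<one>, y) \<in> adj ^^ n" "(y, x) \<in> adj"
      using k by auto
    then have "y \<in> ball n"
      unfolding cayley_ball_def by auto
    then show ?thesis
      using y(2) that adj_iff by blast
  qed
qed

lemma ball_closed: "ball n \<subseteq> carrier G"
proof (induction n)
  case 0
  then show ?case by (simp add: ball_0)
next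
  case (Suc n)
  then show ?case
    using generators_closed by (auto elim!: ball_SucE)
qed

lemma one_in_ball: "\<one> \<in> ball n"
  using ball_0 ball_mono[of 0 n] by auto

lemma finite_ball: "finite (ball n)"
proof (induction n)
  case 0
  then show ?case by (simp add: ball_0)
next
  case (Suc n)
  have "ball (Suc n) \<subseteq> ball n \<union> (\<lambda>(x, s). x \<otimes> s) ` (ball n \<times> S)"
    by (auto elim!: ball_SucE)
  then show ?case
    using Suc finite_generators by (meson finite_SigmaI finite_UnI finite_imageI finite_subset)
qed

lemma ball_mult:
  assumes "x \<in> ball m" "y \<in> ball n"
  shows "x \<otimes> y \<in> ball (m + n)"
  using assms(2)
proof (induction n arbitrary: y)
  case 0
  then show ?case
    using assms(1) ball_closed[of m] by (auto simp: ball_0)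
next
  case (Suc n)
  from Suc.prems show ?case
  proof (cases rule: ball_SucE)
    case 1
    then show ?thesis
      using Suc.IH ball_mono[of "m + n" "m + Suc n"] by auto
  next
    case (2 z s)
    have c: "x \<in> carrier G" "s \<in> carrier G"
      using assms(1) ball_closed 2 generators_closed by auto
    then have "(x \<otimes> z) \<otimes> s \<in> ball (Suc (m + n))"
      using 2 Suc.IH by (intro ball_SucI) auto
    then show ?thesis
      using 2 c by (simp add: m_assoc)
  qed
qed

lemma generator_in_ball: "s \<in> S \<Longrightarrow> s \<in> ball 1"
  using ball_SucI[of \<one> 0 s] generators_closed by (auto simp: ball_0)

lemma ball_inv: "x \<in> ball n \<Longrightarrow> inv x \<in> ball n"
proof (induction n arbitrary: x)
  case 0
  then show ?case by (simp add: ball_0)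
next
  case (Suc n)
  from Suc.prems show ?case
  proof (cases rule: ball_SucE)
    case 1
    then show ?thesis
      using Suc.IH ball_mono[of n "Suc n"] by auto
  next
    case (2 z s)
    have "inv s \<otimes> inv z \<in> ball (1 + n)"
      using 2 Suc.IH generator_in_ball generators_inv by (intro ball_mult) auto
    then show ?thesis
      using 2 generators_closed by (auto simp: inv_mult_group)
  qed
qed

lemma in_some_ball: "x \<in> carrier G \<Longrightarrow> \<exists>n. x \<in> ball n"
proof -
  assume "x \<in> carrier G"
  then have "x \<in> generate G S"
    by (simp add: generate_generators)
  then show ?thesis
  proof (induction rule: generate.induct)
    case one
    then show ?case using one_in_ball by blast
  next
    case (incl h)
    then show ?case using generator_in_ball by blast
  next
    case (inv h)
    then show ?case using generator_in_ball generators_inv by blast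
  next
    case (eng h1 h2)
    then show ?case using ball_mult by blast
  qed
qed

lemma finite_subset_ball:
  assumes "finite A" "A \<subseteq> carrier G"
  shows "\<exists>n. A \<subseteq> ball n"
  using assms
proof (induction A rule: finite_induct)
  case empty
  then show ?case by simp
next
  case (insert x A)
  then obtain n where "A \<subseteq> ball n"
    by auto
  moreover obtain m where "x \<in> ball m"
    using insert.prems in_some_ball by auto
  ultimately have "insert x A \<subseteq> ball (max m n)"
    using ball_mono[of m "max m n"] ball_mono[of n "max m n"] by auto
  then show ?case by blast
qed

end

text \<open>Homomorphisms are Lipschitz for word metrics. Applied to the inclusions and projections of
  a direct product, this compares the given generators of the product with those of the factors.\<close>

lemma hom_ball:
  assumes "cayley K A" "cayley G S" "\<phi> \<in> hom K G" "\<phi> ` A \<subseteq> cayley_ball G S L"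
    and "x \<in> cayley_ball K A n"
  shows "\<phi> x \<in> cayley_ball G S (L * n)"
proof -
  interpret K: cayley K A by fact
  interpret G: cayley G S by fact
  show ?thesis
    using assms(5)
  proof (induction n arbitrary: x)
    case 0
    then show ?case
      using hom_one[OF assms(3) K.is_group G.is_group] by (simp add: K.ball_0 G.ball_0)
  next
    case (Suc n)
    from Suc.prems show ?case
    proof (cases rule: K.ball_SucE)
      case 1
      then show ?thesis
        using Suc.IH G.ball_mono[of "L * n" "L * Suc n"] by auto
    next
      case (2 y s)
      have "\<phi> y \<otimes>\<^bsub>G\<^esub> \<phi> s \<in> cayley_ball G S (L * n + L)"
        using 2 Suc.IH assms(4) by (intro G.ball_mult) auto
      moreover have "\<phi> x = \<phi> y \<otimes>\<^bsub>G\<^esub> \<phi> s"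
        using 2 assms(3) K.generators_closed by (auto simp: hom_mult)
      ultimately show ?thesis
        by (simp add: add.commute)
    qed
  qed
qed

section \<open>Isoperimetry\<close>

context cayley
begin

definition outer_boundary :: "'a set \<Rightarrow> 'a set" where
  "outer_boundary A = adj `` A - A"

lemma finite_outer_boundary: "finite A \<Longrightarrow> finite (outer_boundary A)"
proof -
  assume "finite A"
  moreover have "outer_boundary A \<subseteq> (\<lambda>(x, s). x \<otimes> s) ` (A \<times> S)"
    unfolding outer_boundary_def by (auto simp: adj_iff)
  ultimately show ?thesis
    using finite_generators by (meson finite_SigmaI finite_imageI finite_subset)
qed

text \<open>Each \<open>a \<in> A\<close> with \<open>a \<otimes> b \<notin> A\<close> leaves \<open>A\<close> at some letter of a word for \<open>b\<close>. For a fixed letter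
  different \<open>a\<close> exit at different boundary points, because right translation is injective.\<close>

lemma card_pushed_out:
  assumes "finite A" "A \<subseteq> carrier G" "b \<in> ball n"
  shows "card {a \<in> A. a \<otimes> b \<notin> A} \<le> n * card (outer_boundary A)"
  using assms(3)
proof (induction n arbitrary: b)
  case 0
  then have "{a \<in> A. a \<otimes> b \<notin> A} = {}"
    using assms(2) by (auto simp: ball_0 dest: subsetD)
  then show ?case by (simp only: card.empty)
next
  case (Suc n)
  from Suc.prems show ?case
  proof (cases rule: ball_SucE)
    case 1
    then show ?thesis
      using Suc.IH[of b] by simp
  next
    case (2 c s)
    let ?Q = "{a \<in> A. a \<otimes> c \<in> A \<and> a \<otimes> b \<notin> A}"
    have s: "s \<in> carrier G"
      using 2 generators_closed by auto
    then have ab: "a \<otimes> b = (a \<otimes> c) \<otimes> s" if "a \<in> A" for a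
      using that assms(2) 2 by (auto simp: m_assoc)
    have b: "b \<in> carrier G"
      using 2 s by auto
    have "card ?Q \<le> card (outer_boundary A)"
    proof (rule card_inj_on_le)
      show "inj_on (\<lambda>a. a \<otimes> b) ?Q"
        using assms(2) b by (intro inj_onI) (simp add: subset_iff)
      show "(\<lambda>a. a \<otimes> b) ` ?Q \<subseteq> outer_boundary A"
        using ab 2 assms(2) unfolding outer_boundary_def Image_def by (auto simp: adj_iff)
      show "finite (outer_boundary A)"
        using assms(1) by (rule finite_outer_boundary)
    qed
    moreover have "card {a \<in> A. a \<otimes> b \<notin> A} \<le> card ({a \<in> A. a \<otimes> c \<notin> A} \<union> ?Q)"
      using assms(1) by (intro card_mono) auto
    moreover have "\<dots> \<le> card {a \<in> A. a \<otimes> c \<notin> A} + card ?Q"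
      by (rule card_Un_le)
    ultimately show ?thesis
      using Suc.IH[of c] 2 by simp
  qed
qed

text \<open>The averaging argument of Coulhon and Saloff-Coste: for a fixed \<open>a\<close> at most \<open>|A|\<close>, hence at most half,
  of the \<open>b\<close> in the ball keep \<open>a \<otimes> b\<close> inside \<open>A\<close>. So an average \<open>b\<close> pushes at least half of \<open>A\<close>
  out of \<open>A\<close>, and \<open>card_pushed_out\<close> bounds how many points any \<open>b\<close> can push out.\<close>

lemma isoperimetry:
  assumes "finite A" "A \<subseteq> carrier G" "2 * card A \<le> card (ball r)"
  shows "card A \<le> 2 * r * card (outer_boundary A)"
proof -
  let ?B = "ball r"
  have split: "card A = card {a \<in> A. a \<otimes> b \<in> A} + card {a \<in> A. a \<otimes> b \<notin> A}" for b
    using assms(1) by (subst card_Un_disjoint[symmetric]) (auto intro: arg_cong[of _ _ card])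
  have "(\<Sum>b\<in>?B. card {a \<in> A. a \<otimes> b \<in> A}) = (\<Sum>a\<in>A. card {b \<in> ?B. a \<otimes> b \<in> A})"
    using assms(1) finite_ball by (intro sum_multicount_gen) auto
  also have "\<dots> \<le> (\<Sum>a\<in>A. card A)"
  proof (rule sum_mono)
    fix a assume "a \<in> A"
    then have a: "a \<in> carrier G"
      using assms(2) by auto
    show "card {b \<in> ?B. a \<otimes> b \<in> A} \<le> card A"
      using a ball_closed[of r] assms(1)
      by (intro card_inj_on_le[of "\<lambda>b. a \<otimes> b"]) (auto intro!: inj_onI simp: subset_iff)
  qed
  finally have kept: "(\<Sum>b\<in>?B. card {a \<in> A. a \<otimes> b \<in> A}) \<le> card A * card A"
    by simp
  have "(\<Sum>b\<in>?B. card {a \<in> A. a \<otimes> b \<notin> A}) \<le> (\<Sum>b\<in>?B. r * card (outer_boundary A))"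
    using card_pushed_out[OF assms(1,2)] by (intro sum_mono) auto
  then have lost: "(\<Sum>b\<in>?B. card {a \<in> A. a \<otimes> b \<notin> A}) \<le> card ?B * (r * card (outer_boundary A))"
    by simp
  have "card ?B * card A = (\<Sum>b\<in>?B. card {a \<in> A. a \<otimes> b \<in> A} + card {a \<in> A. a \<otimes> b \<notin> A})"
    by (simp add: split[symmetric])
  then have "card ?B * card A \<le> card A * card A + card ?B * (r * card (outer_boundary A))"
    using kept lost by (simp add: sum.distrib)
  moreover have "2 * (card A * card A) \<le> card ?B * card A"
    using mult_le_mono1[OF assms(3), of "card A"] by (simp add: algebra_simps)
  moreover have "card ?B * (2 * r * card (outer_boundary A)) = 2 * (card ?B * (r * card (outer_boundary A)))"
    by simp
  ultimately have "card ?B * card A \<le> card ?B * (2 * r * card (outer_boundary A))"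
    by linarith
  moreover have "card ?B > 0"
    using one_in_ball finite_ball by (auto simp: card_gt_0_iff)
  ultimately show ?thesis
    by simp
qed

section \<open>Spread of the fire\<close>

abbreviation burning :: "'a set \<Rightarrow> (nat \<Rightarrow> 'a set) \<Rightarrow> nat \<Rightarrow> 'a set" where
  "burning \<equiv> fire adj"

lemma fire_mono: "m \<le> n \<Longrightarrow> burning F0 W m \<subseteq> burning F0 W n"
  by (rule lift_Suc_mono_le[of "burning F0 W"]) auto

lemma fire_in_ball: "F0 \<subseteq> ball r \<Longrightarrow> burning F0 W n \<subseteq> ball (r + n)"
proof (induction n)
  case 0
  then show ?case by simp
next
  case (Suc n)
  have "adj `` burning F0 W n \<subseteq> ball (Suc (r + n))"
    using Suc by (auto simp: adj_iff intro!: ball_SucI)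
  then show ?case
    using Suc ball_mono[of "r + n" "Suc (r + n)"] by auto
qed

lemma fire_closed:
  assumes "F0 \<subseteq> carrier G"
  shows "burning F0 W n \<subseteq> carrier G"
proof (induction n)
  case 0
  then show ?case using assms by simp
next
  case (Suc n)
  then show ?case
    using generators_closed by (auto simp: adj_iff subset_iff)
qed

end

definition protected :: "(nat \<Rightarrow> 'a set) \<Rightarrow> nat \<Rightarrow> 'a set" where
  "protected W n = (\<Union>i\<in>{1..n}. W i)"

lemma protected_mono: "m \<le> n \<Longrightarrow> protected W m \<subseteq> protected W n"
  unfolding protected_def by fastforce

lemma allowed_protected:
  assumes "allowed_strategy V E f F0 W"
  shows "finite (protected W n)" "protected W n \<subseteq> V"
    and "card (protected W n) \<le> (\<Sum>i=1..n. f i)"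
proof -
  have W: "finite (W i)" "W i \<subseteq> V" "card (W i) \<le> f i" if "i \<in> {1..n}" for i
    using assms that unfolding allowed_strategy_def by auto
  show "finite (protected W n)" "protected W n \<subseteq> V"
    unfolding protected_def using W by blast+
  have "card (protected W n) \<le> (\<Sum>i=1..n. card (W i))"
    unfolding protected_def by (rule card_UN_le) simp
  also have "\<dots> \<le> (\<Sum>i=1..n. f i)"
    using W by (intro sum_mono) auto
  finally show "card (protected W n) \<le> (\<Sum>i=1..n. f i)" .
qed

lemma power_Suc_increment:
  fixes M :: nat
  assumes "M \<ge> 1"
  shows "(M + 1) ^ Suc p \<le> M ^ Suc p + 3 ^ Suc p * M ^ p"
proof (induction p)
  case 0
  then show ?case by simp
next
  case (Suc p)
  let ?a = "M ^ p" and ?t = "3 ^ Suc p :: nat"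
  have "(M + 1) ^ Suc (Suc p) = (M + 1) ^ Suc p * (M + 1)"
    by simp
  also have "\<dots> \<le> (M * ?a + ?t * ?a) * (M + 1)"
    using Suc by (intro mult_le_mono1) simp
  also have "\<dots> = M * (M * ?a) + M * ?a + ?t * (M * ?a) + ?t * ?a"
    by (simp only: algebra_simps)
  also have "\<dots> \<le> M * (M * ?a) + ?t * (M * ?a) + ?t * (M * ?a) + ?t * (M * ?a)"
    using assms by (intro add_mono mult_le_mono2) auto
  also have "\<dots> = M ^ Suc (Suc p) + 3 ^ Suc (Suc p) * M ^ Suc p"
    by simp
  finally show ?case .
qed

context cayley
begin

lemma fire_step_card:
  assumes "allowed_strategy (carrier G) adj f F0 W" "finite (burning F0 W n)"
  shows "finite (burning F0 W (Suc n))"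
    and "card (burning F0 W n) + card (outer_boundary (burning F0 W n))
      \<le> card (burning F0 W (Suc n)) + card (protected W (Suc n))"
proof -
  let ?F = "burning F0 W n"
  let ?P = "protected W (Suc n)"
  have eq: "burning F0 W (Suc n) = ?F \<union> (outer_boundary ?F - ?P)"
    by (auto simp: outer_boundary_def protected_def)
  have fin: "finite (outer_boundary ?F)" "finite ?P"
    using finite_outer_boundary assms(2) allowed_protected(1)[OF assms(1)] by auto
  show "finite (burning F0 W (Suc n))"
    unfolding eq using fin assms(2) by simp
  have "card (burning F0 W (Suc n)) = card ?F + card (outer_boundary ?F - ?P)"
    unfolding eq using fin assms(2)
    by (intro card_Un_disjoint) (auto simp: outer_boundary_def)
  moreover have "card (outer_boundary ?F) - card ?P \<le> card (outer_boundary ?F - ?P)"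
    using fin by (intro diff_card_le_card_Diff)
  ultimately show "card ?F + card (outer_boundary ?F) \<le> card (burning F0 W (Suc n)) + card ?P"
    by linarith
qed

text \<open>The invariant is \<open>M\<^sup>p\<^sup>+\<^sup>1 \<le> |F\<^sub>n|\<close> for \<open>M = n + N\<close>, with a large shift \<open>N\<close>. If the fire is not yet
  of size \<open>(M + 1)\<^sup>p\<^sup>+\<^sup>1\<close>, isoperimetry with radius \<open>r = M / k\<close> gives a boundary of size at least
  \<open>|F\<^sub>n| / (2 r)\<close>, a large multiple of \<open>M\<^sup>p\<close>. This pays for the increment of \<open>M\<^sup>p\<^sup>+\<^sup>1\<close>
  and for all protected vertices. They number at most \<open>M\<^sup>p\<close>, as \<open>q < p\<close>. The shift, and with it the
  initial set, depends on the budget only and not on the strategy.\<close>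

lemma superpolynomial_fire:
  assumes growth: "\<And>p. eventually (\<lambda>r. r ^ p \<le> card (ball r)) sequentially"
    and budget: "\<And>n. (\<Sum>i=1..n. f i) \<le> c * (n + 1) ^ q"
    and "q < p"
  shows "\<exists>F0. finite F0 \<and> F0 \<subseteq> carrier G \<and>
    (\<forall>W. allowed_strategy (carrier G) adj f F0 W \<longrightarrow>
      (\<forall>n. n ^ Suc p \<le> card (burning F0 W n)))"
proof -
  \<comment> \<open>The factor \<open>3 ^ Suc p\<close> pays for the increment of the power, the extra \<open>1\<close> for the protected
    vertices, and the factor \<open>2\<close> is the one in the isoperimetric inequality.\<close>
  define k :: nat where "k = 2 * (3 ^ Suc p + 1)"
  have k: "k \<ge> 1"
    unfolding k_def by simp
  obtain r0 where r0: "r ^ Suc (Suc p) \<le> card (ball r)" if "r \<ge> r0" for r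
    using growth[of "Suc (Suc p)"] unfolding eventually_sequentially by auto
  define r1 where "r1 = r0 + 2 * (2 * k) ^ Suc p"
  define N where "N = k * r1 + c * 2 ^ q + 1"
  have ball_large: "2 * (M + 1) ^ Suc p \<le> card (ball (M div k))" if "M \<ge> N" for M
  proof -
    let ?r = "M div k"
    have "k * r1 \<le> M"
      using that unfolding N_def by linarith
    then have r: "?r \<ge> r1"
      using k by (metis div_le_mono nonzero_mult_div_cancel_left not_one_le_zero)
    have "2 * (2 * k) ^ Suc p \<ge> 1"
      using k by simp
    then have r1: "r1 \<ge> 1"
      unfolding r1_def by (rule trans_le_add2)
    have "M + 1 \<le> k * (?r + 1)"
      using dividend_less_times_div[of k M] k by simp
    also have "\<dots> \<le> k * (2 * ?r)"
      using r r1 by (intro mult_le_mono2) linarith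
    finally have "(M + 1) ^ Suc p \<le> (2 * k * ?r) ^ Suc p"
      by (intro power_mono) (auto simp: algebra_simps)
    then have "2 * (M + 1) ^ Suc p \<le> 2 * (2 * k) ^ Suc p * ?r ^ Suc p"
      by (simp only: power_mult_distrib mult.assoc mult_le_mono2)
    also have "\<dots> \<le> ?r * ?r ^ Suc p"
      using r unfolding r1_def by (intro mult_le_mono1) linarith
    also have "\<dots> \<le> card (ball ?r)"
      using r0[of ?r] r unfolding r1_def by simp
    finally show ?thesis .
  qed
  have budget_small: "(\<Sum>i=1..Suc n. f i) \<le> (n + N) ^ p" for n
  proof -
    let ?M = "n + N"
    have M: "?M \<ge> n + 1" "?M \<ge> c * 2 ^ q"
      unfolding N_def by auto
    have "(\<Sum>i=1..Suc n. f i) \<le> c * (n + 2) ^ q"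
      using budget[of "Suc n"] by simp
    also have "\<dots> \<le> c * (2 * ?M) ^ q"
      using M by (intro mult_le_mono2 power_mono) auto
    also have "\<dots> = c * 2 ^ q * ?M ^ q"
      by (simp only: power_mult_distrib mult.assoc)
    also have "\<dots> \<le> ?M * ?M ^ q"
      using M(2) by (rule mult_le_mono1)
    also have "\<dots> = ?M ^ Suc q"
      by simp
    also have "\<dots> \<le> ?M ^ p"
      using assms(3) M(1) by (intro power_increasing) auto
    finally show ?thesis .
  qed
  obtain r2 where r2: "r \<le> card (ball r)" if "r \<ge> r2" for r
    using growth[of 1] unfolding eventually_sequentially by auto
  define F0 where "F0 = ball (r2 + N ^ Suc p)"
  have F0: "N ^ Suc p \<le> card F0"
    using r2[of "r2 + N ^ Suc p"] unfolding F0_def by linarith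
  have "finite (burning F0 W n) \<and> (n + N) ^ Suc p \<le> card (burning F0 W n)"
    if W: "allowed_strategy (carrier G) adj f F0 W" for W n
  proof (induction n)
    case 0
    then show ?case
      using F0 finite_ball unfolding F0_def by simp
  next
    case (Suc n)
    let ?M = "n + N"
    let ?F = "burning F0 W n"
    let ?D = "outer_boundary ?F"
    have fin: "finite (burning F0 W (Suc n))"
      and step: "card ?F + card ?D \<le> card (burning F0 W (Suc n)) + card (protected W (Suc n))"
      using fire_step_card[OF W] Suc by auto
    have "(?M + 1) ^ Suc p \<le> card (burning F0 W (Suc n))"
    proof (cases "(?M + 1) ^ Suc p \<le> card ?F")
      case True
      also have "card ?F \<le> card (burning F0 W (Suc n))"
        using fin fire_mono[of n "Suc n"] by (intro card_mono) auto
      finally show ?thesis .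
    next
      case False
      let ?r = "?M div k"
      have "2 * card ?F \<le> card (ball ?r)"
        using ball_large[of ?M] False by simp
      then have "card ?F \<le> 2 * ?r * card ?D"
        using Suc fire_closed[of F0 W n] ball_closed unfolding F0_def by (intro isoperimetry) auto
      then have "(3 ^ Suc p + 1) * ?M ^ Suc p \<le> (3 ^ Suc p + 1) * (2 * ?r * card ?D)"
        using Suc by (intro mult_le_mono2) linarith
      also have "\<dots> = k * ?r * card ?D"
        unfolding k_def by (simp add: algebra_simps)
      also have "\<dots> \<le> ?M * card ?D"
        by (intro mult_le_mono1) simp
      finally have "?M * ((3 ^ Suc p + 1) * ?M ^ p) \<le> ?M * card ?D"
        by (simp add: algebra_simps)
      moreover have M: "0 < ?M"
        unfolding N_def by simp
      ultimately have D: "(3 ^ Suc p + 1) * ?M ^ p \<le> card ?D"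
        by (rule mult_left_le_imp_le)
      have "card (protected W (Suc n)) \<le> ?M ^ p"
        using allowed_protected(3)[OF W, of "Suc n"] budget_small[of n] by linarith
      moreover have "(?M + 1) ^ Suc p \<le> ?M ^ Suc p + 3 ^ Suc p * ?M ^ p"
        using M by (intro power_Suc_increment) linarith
      moreover have "?M ^ Suc p + 3 ^ Suc p * ?M ^ p + ?M ^ p \<le> card ?F + card ?D"
        using D Suc by (simp only: distrib_right mult_1) linarith
      ultimately show ?thesis
        using step by linarith
    qed
    then show ?case
      using fin by simp
  qed
  moreover have "n ^ Suc p \<le> (n + N) ^ Suc p" for n
    by (intro power_mono) auto
  moreover have "finite F0" "F0 \<subseteq> carrier G"
    using finite_ball ball_closed unfolding F0_def by auto
  ultimately show ?thesis
    by (meson le_trans)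
qed

text \<open>Vertices from which a protected vertex lies within distance \<open>L\<close>: the fire may
  fail to enter them along a detour of length \<open>L\<close>.\<close>

definition thicken :: "nat \<Rightarrow> 'a set \<Rightarrow> 'a set" where
  "thicken L P = (\<lambda>(p, b). p \<otimes> b) ` (P \<times> ball L)"

lemma thicken_card:
  assumes "finite P"
  shows "finite (thicken L P)" "card (thicken L P) \<le> card P * card (ball L)"
proof -
  show "finite (thicken L P)"
    unfolding thicken_def using assms finite_ball by auto
  have "card (thicken L P) \<le> card (P \<times> ball L)"
    unfolding thicken_def using assms finite_ball by (intro card_image_le) auto
  then show "card (thicken L P) \<le> card P * card (ball L)"
    by (simp add: card_cartesian_product)
qed

text \<open>It is enough that the endpoint of the path avoids the thickened set: a protected vertex on
  the way would be at distance at most \<open>n\<close> from the endpoint.\<close>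

lemma fire_jump:
  assumes P: "protected W \<tau> \<subseteq> carrier G"
    and x: "x \<in> burning F0 W t" "x \<in> carrier G"
  shows "\<lbrakk>y \<in> ball n; t + n \<le> \<tau>; x \<otimes> y \<notin> thicken n (protected W \<tau>)\<rbrakk>
    \<Longrightarrow> x \<otimes> y \<in> burning F0 W (t + n)"
proof (induction n arbitrary: y)
  case 0
  then show ?case
    using x by (simp add: ball_0)
next
  case (Suc n)
  have sub: "thicken n (protected W \<tau>) \<subseteq> thicken (Suc n) (protected W \<tau>)"
    unfolding thicken_def using ball_mono[of n "Suc n"] by auto
  from Suc.prems(1) show ?case
  proof (cases rule: ball_SucE)
    case 1
    then have "x \<otimes> y \<in> burning F0 W (t + n)"
      using Suc sub by auto
    then show ?thesis
      using fire_mono[of "t + n" "t + Suc n"] by auto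
  next
    case (2 z s)
    have s: "s \<in> carrier G"
      using 2 generators_closed by auto
    have xy: "x \<otimes> y = (x \<otimes> z) \<otimes> s"
      using 2 s x(2) by (simp add: m_assoc)
    have "x \<otimes> z \<notin> thicken n (protected W \<tau>)"
    proof
      assume "x \<otimes> z \<in> thicken n (protected W \<tau>)"
      then obtain p b where pb: "p \<in> protected W \<tau>" "b \<in> ball n" "x \<otimes> z = p \<otimes> b"
        unfolding thicken_def by auto
      then have "b \<in> carrier G" "p \<in> carrier G"
        using ball_closed P by auto
      then have "x \<otimes> y = p \<otimes> (b \<otimes> s)" "b \<otimes> s \<in> ball (Suc n)"
        using pb xy s 2 by (auto simp: m_assoc intro: ball_SucI)
      then have "x \<otimes> y \<in> thicken (Suc n) (protected W \<tau>)"
        using pb(1) unfolding thicken_def by force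
      then show False
        using Suc.prems by simp
    qed
    then have burnt: "x \<otimes> z \<in> burning F0 W (t + n)"
      using Suc.IH[of z] Suc.prems 2 by simp
    have "x \<otimes> y \<notin> protected W \<tau>"
    proof
      assume p: "x \<otimes> y \<in> protected W \<tau>"
      then have "x \<otimes> y = (x \<otimes> y) \<otimes> \<one>"
        using P by auto
      then have "x \<otimes> y \<in> thicken (Suc n) (protected W \<tau>)"
        using p one_in_ball[of "Suc n"] unfolding thicken_def by force
      then show False
        using Suc.prems by simp
    qed
    then have "x \<otimes> y \<notin> protected W (Suc (t + n))"
      using protected_mono[of "Suc (t + n)" \<tau> W] Suc.prems by auto
    moreover have "(x \<otimes> z, x \<otimes> y) \<in> adj"
      using 2 x(2) xy by (auto simp: adj_iff)
    ultimately show ?thesis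
      using burnt unfolding protected_def by auto
  qed
qed

text \<open>Every edge of the coset \<open>x \<otimes> \<phi>(K)\<close> is realised by a path of length \<open>L\<close> that may leave the
  coset. Only its endpoints, which lie in the coset, have to be clean.\<close>

lemma fire_along_coset:
  assumes "cayley K A" and \<phi>: "\<phi> \<in> hom K G" "\<phi> ` A \<subseteq> ball L"
    and P: "protected W \<tau> \<subseteq> carrier G"
    and x: "x \<in> burning F0 W t" "x \<in> carrier G"
    and clean: "\<And>k. k \<in> carrier K \<Longrightarrow> x \<otimes> \<phi> k \<notin> thicken L (protected W \<tau>)"
  shows "\<lbrakk>k \<in> cayley_ball K A n; t + L * n \<le> \<tau>\<rbrakk> \<Longrightarrow> x \<otimes> \<phi> k \<in> burning F0 W (t + L * n)"
proof (induction n arbitrary: k)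
  case 0
  interpret K: cayley K A by fact
  show ?case
    using 0 x hom_one[OF \<phi>(1) K.is_group is_group] by (simp add: K.ball_0)
next
  case (Suc n)
  interpret K: cayley K A by fact
  from Suc.prems(1) show ?case
  proof (cases rule: K.ball_SucE)
    case 1
    then have "x \<otimes> \<phi> k \<in> burning F0 W (t + L * n)"
      using Suc by auto
    then show ?thesis
      using fire_mono[of "t + L * n" "t + L * Suc n"] by auto
  next
    case (2 l s)
    have s: "s \<in> carrier K"
      using 2 K.generators_closed by auto
    have c: "\<phi> l \<in> carrier G" "\<phi> s \<in> carrier G"
      using \<phi>(1) 2 s by (auto dest: hom_in_carrier)
    have eq: "x \<otimes> \<phi> k = (x \<otimes> \<phi> l) \<otimes> \<phi> s"
      using 2 s c x(2) \<phi>(1) by (simp add: hom_mult m_assoc)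
    have "x \<otimes> \<phi> l \<in> burning F0 W (t + L * n)"
      using Suc 2 by auto
    then have "(x \<otimes> \<phi> l) \<otimes> \<phi> s \<in> burning F0 W ((t + L * n) + L)"
    proof (rule fire_jump[OF P])
      show "x \<otimes> \<phi> l \<in> carrier G" "\<phi> s \<in> ball L"
        using x(2) c 2 \<phi>(2) by auto
      show "t + L * n + L \<le> \<tau>"
        using Suc.prems by simp
      show "x \<otimes> \<phi> l \<otimes> \<phi> s \<notin> thicken L (protected W \<tau>)"
        using clean[of k] 2 s eq by auto
    qed
    then show ?thesis
      by (simp only: eq mult_Suc_right add.assoc add.commute[of L])
  qed
qed

end

section \<open>Growth\<close>

lemma eventually_power_le_exponential:
  fixes \<gamma> :: real
  assumes "\<gamma> > 1"
  shows "eventually (\<lambda>n. C * ((K * (real n + 1)) ^ p + 1) \<le> \<gamma> ^ n) sequentially"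
proof -
  have "(\<lambda>n. K * (real n + 1)) \<in> O(\<lambda>n. real n)"
    by real_asymp
  then have "(\<lambda>n. (K * (real n + 1)) ^ p) \<in> O(\<lambda>n. real n ^ p)"
    by (rule landau_o.big_power)
  moreover have "(\<lambda>n. 1 :: real) \<in> O(\<lambda>n. real n ^ p)"
    by (intro bigoI[of _ 1] eventually_sequentiallyI[of 1]) simp
  ultimately have "(\<lambda>n. (K * (real n + 1)) ^ p + 1) \<in> O(\<lambda>n. real n ^ p)"
    by (rule sum_in_bigo)
  then have "(\<lambda>n. C * ((K * (real n + 1)) ^ p + 1)) \<in> O(\<lambda>n. real n ^ p)"
    by simp
  also have "(\<lambda>n. real n ^ p) \<in> o(\<lambda>n. \<gamma> ^ n)"
    using assms by real_asymp
  finally have "(\<lambda>n. C * ((K * (real n + 1)) ^ p + 1)) \<in> o(\<lambda>n. \<gamma> ^ n)" .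
  then have "eventually (\<lambda>n. norm (C * ((K * (real n + 1)) ^ p + 1)) \<le> 1 * norm (\<gamma> ^ n)) sequentially"
    by (rule landau_o.smallD) simp
  then show ?thesis
    by eventually_elim (use assms in auto)
qed

text \<open>The comparison of \<open>growth G S\<close> with \<open>\<gamma> ^ n\<close> rescales the radius by a constant, and so does the
  passage to \<open>\<Gamma>\<close>. This changes the base of the exponential, but not that it beats every power.\<close>

lemma exponential_growth_superpolynomial:
  assumes "cayley \<Gamma> R" "exponential_growth G S" "L \<ge> 1"
    and sub: "\<And>n. card (cayley_ball G S n) \<le> card (cayley_ball \<Gamma> R (L * n))"
  shows "eventually (\<lambda>r. r ^ p \<le> card (cayley_ball \<Gamma> R r)) sequentially"
proof -
  interpret cayley \<Gamma> R by fact
  obtain \<gamma> :: real and C :: nat where \<gamma>: "\<gamma> > 1" and C: "C > 0"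
    and le: "\<And>n. \<gamma> ^ n \<le> real C * growth G S (C * n) + real C"
    using assms(2) unfolding exponential_growth_def growth_equiv_def growth_le_def by blast
  define K where "K = L * C"
  have K: "K \<ge> 1"
    using C assms(3) unfolding K_def by simp
  have "filterlim (\<lambda>r. r div K) sequentially sequentially"
    using K by (intro filterlim_at_top_div_const_nat) simp
  then have "eventually (\<lambda>r. real C * ((real K * (real (r div K) + 1)) ^ p + 1) \<le> \<gamma> ^ (r div K))
      sequentially"
    using eventually_power_le_exponential[OF \<gamma>, of "real C" "real K" p]
    by (rule eventually_compose_filterlim[rotated])
  then show ?thesis
  proof eventually_elim
    case (elim r)
    let ?n = "r div K"
    have "r \<le> K * (?n + 1)"
      using dividend_less_times_div[of K r] K by simp
    then have "r ^ p \<le> (K * (?n + 1)) ^ p"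
      by (rule power_mono) simp
    then have "real (r ^ p) \<le> (real K * (real ?n + 1)) ^ p"
      by (metis (mono_tags, opaque_lifting) of_nat_1 of_nat_add of_nat_mono of_nat_mult of_nat_power)
    moreover have "real C * ((real K * (real ?n + 1)) ^ p + 1) \<le> real C * (growth G S (C * ?n) + 1)"
      using elim le[of ?n] by (simp add: algebra_simps)
    then have "(real K * (real ?n + 1)) ^ p \<le> growth G S (C * ?n)"
      using C by simp
    ultimately have "r ^ p \<le> card (cayley_ball G S (C * ?n))"
      unfolding growth_def by linarith
    also have "\<dots> \<le> card (ball (K * ?n))"
      using sub[of "C * ?n"] unfolding K_def by (simp add: mult.assoc)
    also have "\<dots> \<le> card (ball r)"
      using finite_ball ball_mono[of "K * ?n" r] by (intro card_mono) auto
    finally show ?case .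
  qed
qed

text \<open>The additive constant absorbs the finitely many terms for which the bound
  \<open>\<epsilon> * n ^ (d - 1)\<close> fails.\<close>

lemma smallo_partial_sums:
  fixes f :: "nat \<Rightarrow> nat"
  assumes "(\<lambda>n. real (f n)) \<in> o(\<lambda>n. real n ^ (d - 1))" "d \<ge> 1" "\<epsilon> > 0"
  shows "\<exists>c. \<forall>n. real (\<Sum>i=1..n. f i) \<le> c + \<epsilon> * real n ^ d"
proof -
  have "eventually (\<lambda>n. norm (real (f n)) \<le> \<epsilon> * norm (real n ^ (d - 1))) sequentially"
    using assms(1,3) by (rule landau_o.smallD)
  then obtain n0 where n0: "real (f n) \<le> \<epsilon> * real n ^ (d - 1)" if "n \<ge> n0" for n
    unfolding eventually_sequentially by auto
  have "real (\<Sum>i=1..n. f i) \<le> real (\<Sum>i\<le>n0. f i) + \<epsilon> * real n ^ d" for n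
  proof -
    have "real (\<Sum>i=1..n. f i) = (\<Sum>i=1..n. real (f i))"
      by simp
    also have "\<dots> \<le> (\<Sum>i=1..n. (if i \<le> n0 then real (f i) else 0) + \<epsilon> * real n ^ (d - 1))"
    proof (rule sum_mono)
      fix i assume i: "i \<in> {1..n}"
      then have "\<epsilon> * real i ^ (d - 1) \<le> \<epsilon> * real n ^ (d - 1)"
        using assms(3) by (intro mult_left_mono power_mono) auto
      moreover have "0 \<le> \<epsilon> * real n ^ (d - 1)"
        using assms(3) by simp
      ultimately show "real (f i) \<le> (if i \<le> n0 then real (f i) else 0) + \<epsilon> * real n ^ (d - 1)"
        using n0[of i] by (smt (verit) linorder_linear)
    qed
    also have "\<dots> = (\<Sum>i=1..n. if i \<le> n0 then real (f i) else 0) + \<epsilon> * (real n * real n ^ (d - 1))"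
      by (simp add: sum.distrib)
    also have "real n * real n ^ (d - 1) = real n ^ d"
      using assms(2) by (simp add: power_eq_if)
    also have "(\<Sum>i=1..n. if i \<le> n0 then real (f i) else 0) = (\<Sum>i\<in>{1..n} \<inter> {..n0}. real (f i))"
      by (subst sum.inter_restrict) auto
    also have "\<dots> \<le> (\<Sum>i\<le>n0. real (f i))"
      by (intro sum_mono2) auto
    finally show ?thesis
      by simp
  qed
  then show ?thesis
    by blast
qed

section \<open>Fire in a product\<close>

locale cayley_product = G: cayley G S + H: cayley H T + P: cayley "G \<times>\<times> H" R
  for G :: "('a, 'm) monoid_scheme" (structure) and S
    and H :: "('b, 'n) monoid_scheme" (structure) and T and R
begin

abbreviation inl :: "'a \<Rightarrow> 'a \<times> 'b" where "inl g \<equiv> (g, \<one>\<^bsub>H\<^esub>)"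

abbreviation inr :: "'b \<Rightarrow> 'a \<times> 'b" where "inr h \<equiv> (\<one>\<^bsub>G\<^esub>, h)"

lemma product_homs:
  shows "inl \<in> hom G (G \<times>\<times> H)" "inr \<in> hom H (G \<times>\<times> H)"
    and "fst \<in> hom (G \<times>\<times> H) G" "snd \<in> hom (G \<times>\<times> H) H"
  by (auto simp: hom_def mult_DirProd')

definition comparable :: "nat \<Rightarrow> bool" where
  "comparable L \<longleftrightarrow> L \<ge> 1 \<and> inl ` S \<subseteq> P.ball L \<and> inr ` T \<subseteq> P.ball L \<and>
     fst ` R \<subseteq> G.ball L \<and> snd ` R \<subseteq> H.ball L"

lemma ex_comparable: "\<exists>L. comparable L"
proof -
  have R: "R \<subseteq> carrier G \<times> carrier H"
    using P.generators_closed by simp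
  have "inl ` S \<subseteq> carrier (G \<times>\<times> H)" "inr ` T \<subseteq> carrier (G \<times>\<times> H)"
    "fst ` R \<subseteq> carrier G" "snd ` R \<subseteq> carrier H"
    using G.generators_closed H.generators_closed R by auto
  then obtain a b c e where "inl ` S \<subseteq> P.ball a" "inr ` T \<subseteq> P.ball b"
    "fst ` R \<subseteq> G.ball c" "snd ` R \<subseteq> H.ball e"
    using P.finite_subset_ball G.finite_subset_ball H.finite_subset_ball
      G.finite_generators H.finite_generators P.finite_generators by (metis finite_imageI)
  then have "comparable (1 + a + b + c + e)"
    unfolding comparable_def
    using P.ball_mono[of a "1 + a + b + c + e"] P.ball_mono[of b "1 + a + b + c + e"]
      G.ball_mono[of c "1 + a + b + c + e"] H.ball_mono[of e "1 + a + b + c + e"] by auto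
  then show ?thesis ..
qed

lemma inl_ball: "comparable L \<Longrightarrow> g \<in> G.ball n \<Longrightarrow> inl g \<in> P.ball (L * n)"
  using hom_ball[OF G.cayley_axioms P.cayley_axioms product_homs(1), of L] by (simp add: comparable_def)

lemma ball_fst: "comparable L \<Longrightarrow> x \<in> P.ball n \<Longrightarrow> fst x \<in> G.ball (L * n)"
  using hom_ball[OF P.cayley_axioms G.cayley_axioms product_homs(3), of L] by (simp add: comparable_def)

lemma ball_snd: "comparable L \<Longrightarrow> x \<in> P.ball n \<Longrightarrow> snd x \<in> H.ball (L * n)"
  using hom_ball[OF P.cayley_axioms H.cayley_axioms product_homs(4), of L] by (simp add: comparable_def)

lemma card_ball_product:
  assumes "comparable L"
  shows "card (G.ball n) \<le> card (P.ball (L * n))"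
  using inl_ball[OF assms] P.finite_ball
  by (intro card_inj_on_le[of inl]) (auto intro: inj_onI)

text \<open>The burning set at time \<open>n\<close> is too large to fit into the dirty cosets of \<open>H\<close>, and the dirty cosets
  of \<open>G\<close> are too few to cover the ball in \<open>H\<close>. This supplies a burning \<open>(a, b)\<close> and an
  element \<open>k\<close>, and then \<open>(a, b) \<rightarrow> (a, k) \<rightarrow> (g, k) \<rightarrow> (g, h)\<close> is a route along clean
  cosets. Its three legs have length \<open>2 L n + n\<close>, \<open>3 L n\<close> and \<open>n + L n\<close> in the word metrics of the
  factors, at most \<open>8 L n\<close> together, and each step costs time \<open>L\<close>.\<close>

lemma unburnt_in_dirty_fibres:
  assumes L: "comparable L"
    and W: "protected W \<tau> \<subseteq> carrier (G \<times>\<times> H)" "finite (protected W \<tau>)"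
    and \<tau>: "n + L * (8 * L * n) \<le> \<tau>"
    and F0: "F0 \<subseteq> P.ball n"
    and few: "card (P.thicken L (protected W \<tau>)) < card (H.ball n)"
    and large: "card (P.thicken L (protected W \<tau>)) * card (H.ball (2 * L * n)) < card (P.burning F0 W n)"
  shows "never_on_fire (carrier (G \<times>\<times> H)) P.adj F0 W \<inter> P.ball n
    \<subseteq> fst ` P.thicken L (protected W \<tau>) \<times> H.ball (L * n)"
proof
  let ?Q = "P.thicken L (protected W \<tau>)"
  have fin: "finite ?Q"
    using P.thicken_card W by blast
  have L1: "L \<ge> 1"
    using L unfolding comparable_def by simp
  have gens: "inl ` S \<subseteq> P.ball L" "inr ` T \<subseteq> P.ball L"
    using L unfolding comparable_def by auto
  fix u assume u: "u \<in> never_on_fire (carrier (G \<times>\<times> H)) P.adj F0 W \<inter> P.ball n"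
  obtain g h where gh: "u = (g, h)"
    by force
  have g: "g \<in> G.ball (L * n)" and h: "h \<in> H.ball (L * n)"
    using ball_fst[OF L, of u n] ball_snd[OF L, of u n] u gh by auto
  have unburnt: "u \<notin> P.burning F0 W t" for t
    using u unfolding never_on_fire_def by auto
  have "g \<in> fst ` ?Q"
  proof (rule ccontr)
    assume clean_g: "g \<notin> fst ` ?Q"
    have burning_ball: "P.burning F0 W n \<subseteq> P.ball (2 * n)"
      using P.fire_in_ball[OF F0, of W n] by (simp add: mult_2)
    have "\<not> P.burning F0 W n \<subseteq> fst ` ?Q \<times> H.ball (2 * L * n)"
    proof
      assume "P.burning F0 W n \<subseteq> fst ` ?Q \<times> H.ball (2 * L * n)"
      then have "card (P.burning F0 W n) \<le> card (fst ` ?Q \<times> H.ball (2 * L * n))"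
        using fin H.finite_ball by (intro card_mono) auto
      also have "\<dots> \<le> card ?Q * card (H.ball (2 * L * n))"
        using fin card_image_le[of ?Q fst] by (simp add: card_cartesian_product)
      finally show False
        using large by simp
    qed
    then obtain a b where ab: "(a, b) \<in> P.burning F0 W n"
        "\<not> (a \<in> fst ` ?Q \<and> b \<in> H.ball (2 * L * n))"
      by auto
    then have "(a, b) \<in> P.ball (2 * n)"
      using burning_ball by auto
    then have a: "a \<in> G.ball (2 * L * n)" and b: "b \<in> H.ball (2 * L * n)"
      using ball_fst[OF L, of "(a, b)" "2 * n"] ball_snd[OF L, of "(a, b)" "2 * n"]
      by (simp_all add: mult.left_commute mult.assoc)
    have clean_a: "a \<notin> fst ` ?Q"
      using ab b by auto
    have "\<not> H.ball n \<subseteq> snd ` ?Q"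
    proof
      assume "H.ball n \<subseteq> snd ` ?Q"
      then have "card (H.ball n) \<le> card (snd ` ?Q)"
        using fin by (intro card_mono) auto
      also have "\<dots> \<le> card ?Q"
        using fin by (rule card_image_le)
      finally show False
        using few by simp
    qed
    then obtain k where k: "k \<in> H.ball n" and clean_k: "k \<notin> snd ` ?Q"
      by auto
    have c: "a \<in> carrier G" "b \<in> carrier H" "k \<in> carrier H" "g \<in> carrier G" "h \<in> carrier H"
      using a b k g h G.ball_closed H.ball_closed by auto
    define t1 where "t1 = n + L * (2 * L * n + n)"
    define t2 where "t2 = t1 + L * (2 * L * n + L * n)"
    define t3 where "t3 = t2 + L * (n + L * n)"
    have "6 * (L * n) + 2 * n \<le> 8 * (L * n)"
      using L1 by simp
    then have "L * (6 * (L * n) + 2 * n) \<le> L * (8 * (L * n))"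
      by (rule mult_le_mono2)
    moreover have "t3 = n + L * (6 * (L * n) + 2 * n)"
      unfolding t1_def t2_def t3_def by (simp add: algebra_simps)
    ultimately have t3: "t3 \<le> \<tau>"
      using \<tau> by (simp only: mult.assoc mult.left_commute)
    have t12: "t1 \<le> \<tau>" "t2 \<le> \<tau>"
      using t3 unfolding t2_def t3_def by simp_all
    have "(a, b) \<otimes>\<^bsub>G \<times>\<times> H\<^esub> inr (inv\<^bsub>H\<^esub> b \<otimes>\<^bsub>H\<^esub> k) \<in> P.burning F0 W t1"
      unfolding t1_def
    proof (rule P.fire_along_coset[OF H.cayley_axioms product_homs(2) gens(2) W(1) ab(1)])
      show "(a, b) \<otimes>\<^bsub>G \<times>\<times> H\<^esub> inr x \<notin> ?Q" for x
        using clean_a c by (force simp: image_iff)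
      show "inv\<^bsub>H\<^esub> b \<otimes>\<^bsub>H\<^esub> k \<in> H.ball (2 * L * n + n)"
        using b k by (intro H.ball_mult H.ball_inv)
    qed (use c t12 in \<open>auto simp: t1_def\<close>)
    then have 1: "(a, k) \<in> P.burning F0 W t1"
      using c by (simp add: H.m_assoc[symmetric])
    have "(a, k) \<otimes>\<^bsub>G \<times>\<times> H\<^esub> inl (inv\<^bsub>G\<^esub> a \<otimes>\<^bsub>G\<^esub> g) \<in> P.burning F0 W t2"
      unfolding t2_def
    proof (rule P.fire_along_coset[OF G.cayley_axioms product_homs(1) gens(1) W(1) 1])
      show "(a, k) \<otimes>\<^bsub>G \<times>\<times> H\<^esub> inl x \<notin> ?Q" for x
        using clean_k c by (force simp: image_iff)
      show "inv\<^bsub>G\<^esub> a \<otimes>\<^bsub>G\<^esub> g \<in> G.ball (2 * L * n + L * n)"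
        using a g by (intro G.ball_mult G.ball_inv)
    qed (use c t12 in \<open>auto simp: t2_def\<close>)
    then have 2: "(g, k) \<in> P.burning F0 W t2"
      using c by (simp add: G.m_assoc[symmetric])
    have "(g, k) \<otimes>\<^bsub>G \<times>\<times> H\<^esub> inr (inv\<^bsub>H\<^esub> k \<otimes>\<^bsub>H\<^esub> h) \<in> P.burning F0 W t3"
      unfolding t3_def
    proof (rule P.fire_along_coset[OF H.cayley_axioms product_homs(2) gens(2) W(1) 2])
      show "(g, k) \<otimes>\<^bsub>G \<times>\<times> H\<^esub> inr x \<notin> ?Q" for x
        using clean_g c by (force simp: image_iff)
      show "inv\<^bsub>H\<^esub> k \<otimes>\<^bsub>H\<^esub> h \<in> H.ball (n + L * n)"
        using k h by (intro H.ball_mult H.ball_inv)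
    qed (use c t3 in \<open>auto simp: t3_def\<close>)
    then have "u \<in> P.burning F0 W t3"
      using c by (simp add: gh H.m_assoc[symmetric])
    then show False
      using unburnt by blast
  qed
  then show "u \<in> fst ` ?Q \<times> H.ball (L * n)"
    using gh h by simp
qed

end

theorem corollary1p5:
  fixes G :: "('a, 'm) monoid_scheme" and H :: "('b, 'n) monoid_scheme"
    and S :: "'a set" and T :: "'b set" and R :: "('a \<times> 'b) set"
    and d :: nat and f :: "nat \<Rightarrow> nat"
  assumes "group G" and "symmetric_generating_set G S" and "exponential_growth G S"
    and "group H" and "symmetric_generating_set H T" and "polynomial_growth H T d"
    and "d \<ge> 1"
    and "symmetric_generating_set (G \<times>\<times> H) R"
    and "(\<lambda>n. real (f n)) \<in> o(\<lambda>n. real n ^ (d - 1))"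
  shows "\<not> retainment_property (G \<times>\<times> H) R f"
proof
  interpret cayley_product G S H T R
    using assms(1,2,4,5,8) DirProd_group[OF assms(1,4)]
    unfolding cayley_product_def cayley_def cayley_axioms_def by blast
  assume retain: "retainment_property (G \<times>\<times> H) R f"
  obtain L where L: "comparable L"
    using ex_comparable by blast
  then have L1: "L \<ge> 1"
    unfolding comparable_def by simp
  obtain c1 c2 :: real where c: "c1 > 0" "c2 > 0"
    and poly: "\<And>n. n \<ge> 1 \<Longrightarrow> c1 \<le> growth H T n / real n ^ d \<and> growth H T n / real n ^ d \<le> c2"
    using assms(6) unfolding polynomial_growth_def by blast
  have H_ball: "c1 * real n ^ d \<le> card (H.ball n)" "card (H.ball n) \<le> c2 * real n ^ d"
    if "n \<ge> 1" for n
    using poly[OF that] that by (auto simp: growth_def divide_simps)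
  have superpoly: "eventually (\<lambda>r. r ^ p \<le> card (P.ball r)) sequentially" for p
    using P.cayley_axioms assms(3) L1 card_ball_product[OF L]
    by (rule exponential_growth_superpolynomial)
  obtain b where b: "real (\<Sum>i=1..n. f i) \<le> b + 1 * real n ^ d" for n
    using smallo_partial_sums[OF assms(9,7), of 1] by auto
  define b' where "b' = nat \<lceil>b\<rceil>"
  have b': "b \<le> real b'"
    unfolding b'_def by (rule real_nat_ceiling_ge)
  have budget: "(\<Sum>i=1..n. f i) \<le> (b' + 1) * (n + 1) ^ d" for n
  proof -
    have "real n ^ d \<le> real ((n + 1) ^ d)"
      by (simp add: power_mono)
    then have "(\<Sum>i=1..n. f i) \<le> b' + (n + 1) ^ d"
      using b[of n] b' by linarith
    also have "\<dots> \<le> b' * (n + 1) ^ d + (n + 1) ^ d"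
      by simp
    finally show ?thesis
      by simp
  qed
  obtain F0 where F0: "finite F0" "F0 \<subseteq> carrier (G \<times>\<times> H)"
    and big: "\<And>W n. allowed_strategy (carrier (G \<times>\<times> H)) P.adj f F0 W \<Longrightarrow>
      n ^ Suc (2 * d + 1) \<le> card (P.burning F0 W n)"
    using P.superpolynomial_fire[OF superpoly budget, of "2 * d + 1"] by (metis le_add1 less_add_one mult_2 order_le_less_trans)
  obtain W where W: "allowed_strategy (carrier (G \<times>\<times> H)) P.adj f F0 W"
    and equiv: "growth_equiv
      (\<lambda>n. real (card (never_on_fire (carrier (G \<times>\<times> H)) P.adj F0 W \<inter> P.ball n))) (growth (G \<times>\<times> H) R)"
    using retain F0 unfolding retainment_property_def by blast
  define U where "U = never_on_fire (carrier (G \<times>\<times> H)) P.adj F0 W"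
  obtain r where r: "F0 \<subseteq> P.ball r"
    using P.finite_subset_ball F0 by blast
  define \<beta> where "\<beta> = card (P.ball L)"
  have \<beta>: "\<beta> > 0"
    unfolding \<beta>_def using P.one_in_ball P.finite_ball by (auto simp: card_gt_0_iff)
  \<comment> \<open>The fire needs time \<open>n\<close> to grow and \<open>8 * L * L * n\<close> to travel.\<close>
  define K where "K = 1 + 8 * L * L"
  have K: "K > 0"
    unfolding K_def by simp
  \<comment> \<open>With this choice the dirty vertices at time \<open>K * n\<close> number, up to a constant, at most half of \<open>c1 * n ^ d\<close>, the lower
    bound for the ball in \<open>H\<close>.\<close>
  define \<epsilon> where "\<epsilon> = c1 / (2 * real \<beta> * real K ^ d)"
  have \<epsilon>: "\<epsilon> > 0" "real \<beta> * \<epsilon> * real K ^ d = c1 / 2"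
    unfolding \<epsilon>_def using c \<beta> K by (auto simp: field_simps)
  obtain e where e: "real (\<Sum>i=1..n. f i) \<le> e + \<epsilon> * real n ^ d" for n
    using smallo_partial_sums[OF assms(9,7) \<epsilon>(1)] by auto
  define Q where "Q n = P.thicken L (protected W (K * n))" for n
  have Q_fin: "finite (Q n)" for n
    unfolding Q_def using P.thicken_card allowed_protected[OF W] by blast
  have Q_card: "real (card (Q n)) \<le> \<beta> * e + c1 / 2 * real n ^ d" for n
  proof -
    have "real (card (Q n)) \<le> real (card (protected W (K * n)) * \<beta>)"
      unfolding Q_def \<beta>_def using P.thicken_card(2) allowed_protected(1)[OF W] of_nat_mono by blast
    also have "\<dots> = \<beta> * real (card (protected W (K * n)))"
      by simp
    also have "\<dots> \<le> \<beta> * (e + \<epsilon> * real (K * n) ^ d)"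
    proof (rule mult_left_mono)
      show "real (card (protected W (K * n))) \<le> e + \<epsilon> * real (K * n) ^ d"
        using allowed_protected(3)[OF W, of "K * n"] e[of "K * n"] by linarith
    qed simp
    also have "\<dots> = \<beta> * e + (real \<beta> * \<epsilon> * real K ^ d) * real n ^ d"
      by (simp add: algebra_simps)
    finally show ?thesis
      by (simp only: \<epsilon>(2))
  qed
  define D where "D = c1 * c2 * (2 * real L) ^ d"
  have U_small: "eventually (\<lambda>n. real (card (U \<inter> P.ball n)) \<le> D * real n ^ (2 * d)) sequentially"
    using eventually_ge_at_top[of 1] eventually_ge_at_top[of r]
      eventually_ge_at_top[of "nat \<lceil>2 * \<beta> * e / c1\<rceil> + 1"] eventually_ge_at_top[of "nat \<lceil>D\<rceil> + 1"]
  proof eventually_elim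
    case (elim n)
    have n: "real n \<le> real n ^ d"
      using elim(1) assms(7) by (intro self_le_power) auto
    have "2 * \<beta> * e / c1 < real n"
      using elim(3) by linarith
    then have "\<beta> * e < c1 / 2 * real n"
      using c by (simp add: field_simps)
    also have "\<dots> \<le> c1 / 2 * real n ^ d"
      using n c by (intro mult_left_mono) auto
    finally have Qn: "real (card (Q n)) < c1 * real n ^ d"
      using Q_card[of n] by simp
    have ball2: "real (card (H.ball (2 * L * n))) \<le> c2 * ((2 * real L) ^ d * real n ^ d)"
      using H_ball(2)[of "2 * L * n"] L1 elim(1) by (simp add: power_mult_distrib)
    have QD: "real (card (Q n) * card (H.ball (2 * L * n))) \<le> D * real n ^ (2 * d)"
    proof -
      have "real (card (Q n) * card (H.ball (2 * L * n)))
          \<le> (c1 * real n ^ d) * (c2 * ((2 * real L) ^ d * real n ^ d))"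
        unfolding of_nat_mult using Qn ball2 c by (intro mult_mono) auto
      moreover have "real n ^ (2 * d) = real n ^ d * real n ^ d"
        by (simp add: mult_2 power_add)
      ultimately show ?thesis
        by (simp add: D_def algebra_simps)
    qed
    have "U \<inter> P.ball n \<subseteq> fst ` Q n \<times> H.ball (L * n)"
      unfolding U_def Q_def
    proof (rule unburnt_in_dirty_fibres[OF L])
      show "protected W (K * n) \<subseteq> carrier (G \<times>\<times> H)" "finite (protected W (K * n))"
        using allowed_protected[OF W] by auto
      show "n + L * (8 * L * n) \<le> K * n"
        unfolding K_def by (simp add: algebra_simps)
      show "F0 \<subseteq> P.ball n"
        using r P.ball_mono[OF elim(2)] by simp
      show "card (P.thicken L (protected W (K * n))) < card (H.ball n)"
        using Qn H_ball(1)[OF elim(1)] unfolding Q_def by linarith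
      have "D * real n ^ (2 * d) < real n * real n ^ (2 * d)"
        using elim(1,4) by (intro mult_strict_right_mono) (linarith, simp)
      also have "\<dots> \<le> real n * (real n * real n ^ (2 * d))"
        using elim(1) by simp
      also have "\<dots> = real (n ^ Suc (2 * d + 1))"
        by simp
      also have "\<dots> \<le> real (card (P.burning F0 W n))"
        using big[OF W, of n] by (simp only: of_nat_le_iff)
      finally show "card (P.thicken L (protected W (K * n))) * card (H.ball (2 * L * n))
          < card (P.burning F0 W n)"
        using QD unfolding Q_def by linarith
    qed
    then have "card (U \<inter> P.ball n) \<le> card (fst ` Q n \<times> H.ball (L * n))"
      using Q_fin H.finite_ball by (intro card_mono) auto
    also have "\<dots> \<le> card (Q n) * card (H.ball (2 * L * n))"
      unfolding card_cartesian_product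
      using Q_fin H.finite_ball H.ball_mono[of "L * n" "2 * L * n"]
      by (intro mult_le_mono card_image_le card_mono) auto
    finally show ?case
      using QD by linarith
  qed
  obtain C :: nat where C: "C > 0"
    and grow: "\<And>n. real (card (P.ball n)) \<le> C * real (card (U \<inter> P.ball (C * n))) + C"
    using equiv unfolding growth_equiv_def growth_le_def growth_def U_def by blast
  have "filterlim (\<lambda>n. C * n) sequentially sequentially"
    using C by (intro mult_nat_left_at_top)
  with U_small have "eventually (\<lambda>n. real (card (U \<inter> P.ball (C * n))) \<le> D * real (C * n) ^ (2 * d)) sequentially"
    by (rule eventually_compose_filterlim)
  then have "eventually (\<lambda>n. False) sequentially"
    using superpoly[of "2 * d + 1"] eventually_ge_at_top[of "nat \<lceil>C * D * C ^ (2 * d) + C\<rceil> + 1"]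
  proof eventually_elim
    case (elim n)
    have "real n ^ (2 * d) * real n \<le> card (P.ball n)"
      using of_nat_mono[OF elim(2), where 'a = real] by (simp add: mult.commute)
    also have "\<dots> \<le> C * (D * real (C * n) ^ (2 * d)) + C"
      using grow[of n] elim(1) C by (smt (verit) mult_left_mono of_nat_0_le_iff)
    also have "\<dots> \<le> real n ^ (2 * d) * (C * D * C ^ (2 * d)) + real n ^ (2 * d) * C"
    proof -
      have "1 \<le> real n ^ (2 * d)"
        using elim(3) by (intro one_le_power) linarith
      then show ?thesis
        using C by (simp add: power_mult_distrib algebra_simps)
    qed
    also have "\<dots> = real n ^ (2 * d) * (C * D * C ^ (2 * d) + C)"
      by (simp add: algebra_simps)
    also have "\<dots> < real n ^ (2 * d) * real n"
      using elim(3) by (intro mult_strict_left_mono) (linarith, simp)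
    finally show False
      by simp
  qed
  then show False
    by simp
qed

end
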